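(* Let $\Lambda>0$, let the base station (BS) locations form a homogeneous Poisson point process in $\mathbb{R}^2$ of intensity $\Lambda$, and for each integer $j\geq 1$ let $R_j$ be the Euclidean distance from the origin to the $j$-th nearest BS. Let $\alpha>0$, let $N\geq 1$ be an integer, let $P_2,\dots,P_{N+1}>0$ be constants, and define the aggregate interference $$I=\sum_{j=2}^{N+1}P_jR_j^{-\alpha}.$$ Then, as an identity in $[0,+\infty]$, $$\mathbb{E}(I)=\sum_{j=2}^{N+1}P_j\,\frac{(\Lambda\pi)^{\alpha/2}\,\Gamma\!\left(j-\frac{\alpha}{2}\right)}{\Gamma(j)},$$ where $\Gamma(x)=\int_0^{+\infty}e^{-t}t^{x-1}\,dt$ for every real $x$, this integral taking the value $+\infty$ when $x\leq 0$.
   Context: A mobile user is located at the origin of the plane and is served by the nearest BS; the other BSs are interferers. The BSs are the points of a homogeneous Poisson point process $\Phi$ in $\mathbb{R}^2$ with intensity $\Lambda>0$ (the BS density); in particular the probability that exactly $n$ BSs lie within distance $r$ of the origin is $\frac{(\Lambda\pi r^2)^n}{n!}e^{-\Lambda\pi r^2}$. Almost surely the points of $\Phi$ have distinct distances to the origin, and $R_1<R_2<\cdots$ denote these distances listed in increasing order, so that $R_j$ is the distance from the origin to the $j$-th nearest BS. The constant $\alpha$ is the pathloss distance exponent and $P_j$ is the transmit power of the $j$-th nearest BS. The symbol $\Gamma$ denotes the integral $\int_0^{+\infty}e^{-t}t^{x-1}\,dt$ with values in $(0,+\infty]$, not its analytic continuation. *)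

theory Defs
  imports "HOL-Probability.Probability"
begin

definition locally_finite :: "'b::metric_space set \<Rightarrow> bool" where
  "locally_finite S \<longleftrightarrow> (\<forall>B. bounded B \<longrightarrow> finite (S \<inter> B))"

(* A Poisson process is almost surely simple, so it is modelled as a random locally finite set
   rather than as a random counting measure.  The Poisson weights are written out instead of
   using poisson_pmf, whose rate must be positive: B may be a null set. *)
definition homogeneous_poisson_process ::
    "'a measure \<Rightarrow> real \<Rightarrow> ('a \<Rightarrow> (real^2) set) \<Rightarrow> bool" where
  "homogeneous_poisson_process M \<Lambda> \<Phi> \<longleftrightarrow>
     (\<forall>\<omega>\<in>space M. locally_finite (\<Phi> \<omega>)) \<and>
     (\<forall>B. B \<in> sets borel \<longrightarrow> bounded B \<longrightarrow>
        (\<lambda>\<omega>. card (\<Phi> \<omega> \<inter> B)) \<in> measurable M (count_space UNIV) \<and>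
        (\<forall>n. measure M {\<omega>\<in>space M. card (\<Phi> \<omega> \<inter> B) = n} =
               (\<Lambda> * measure lborel B) ^ n / fact n * exp (- (\<Lambda> * measure lborel B)))) \<and>
     (\<forall>\<B>. finite \<B> \<longrightarrow> disjoint \<B> \<longrightarrow> (\<forall>B\<in>\<B>. B \<in> sets borel \<and> bounded B) \<longrightarrow>
        prob_space.indep_vars M (\<lambda>_. count_space UNIV) (\<lambda>B \<omega>. card (\<Phi> \<omega> \<inter> B)) \<B>)"

definition distance_ordered :: "'b::real_normed_vector set \<Rightarrow> (nat \<Rightarrow> 'b) \<Rightarrow> bool" where
  "distance_ordered S x \<longleftrightarrow>
     bij_betw x {1..} S \<and> (\<forall>i j. 1 \<le> i \<longrightarrow> i \<le> j \<longrightarrow> norm (x i) \<le> norm (x j))"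

(* The j-th nearest point of S to the origin, counting from j = 1.  An ordering exists for every
   infinite locally finite S, and the norms do not depend on the choice made by SOME;
   the points themselves are unique when their distances to the origin are distinct. *)
definition nearest_point :: "'b::real_normed_vector set \<Rightarrow> nat \<Rightarrow> 'b" where
  "nearest_point S = (SOME x. distance_ordered S x)"

definition nearest_dist :: "'b::real_normed_vector set \<Rightarrow> nat \<Rightarrow> real" where
  "nearest_dist S j = dist 0 (nearest_point S j)"

(* HOL-Analysis' Gamma is the analytic continuation (with value 0 at the poles), so it is not
   usable here: it is finite at negative non-integers, where the integral diverges. *)
definition Gamma_integral :: "real \<Rightarrow> ennreal" where
  "Gamma_integral x = (\<integral>\<^sup>+t\<in>{0<..}. ennreal (exp (- t) * t powr (x - 1)) \<partial>lborel)"

lemma Gamma_integral_nonpos: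
  assumes "x \<le> 0"
  shows "Gamma_integral x = \<infinity>"
proof (rule ccontr)
  define c where "c = exp (- (1::real))"
  have c: "c > 0" by (simp add: c_def)
  assume "Gamma_integral x \<noteq> \<infinity>"
  then obtain K where K: "Gamma_integral x = ennreal K" "K \<ge> 0"
    by (cases "Gamma_integral x") auto
  have bound: "c * (ln 1 - ln e) \<le> K" if e: "0 < e" "e < 1" for e
  proof -
    have "(\<integral>\<^sup>+t. ennreal (c * (1 / t)) * indicator {e..1} t \<partial>lborel) =
            ennreal (c * ln 1 - c * ln e)"
    proof (rule nn_integral_FTC_Icc[where F = "\<lambda>t. c * ln t"])
      show "(\<lambda>t::real. c * (1 / t)) \<in> borel_measurable borel" by measurable
      show "e \<le> 1" using e by simp
    next
      fix t assume "t \<in> {e..1}"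
      then show "((\<lambda>t. c * ln t) has_real_derivative c * (1 / t)) (at t)"
        using e by (auto intro!: derivative_eq_intros)
    next
      fix t assume "t \<in> {e..1}"
      then show "0 \<le> c * (1 / t)" using e c by simp
    qed
    moreover have "(\<integral>\<^sup>+t. ennreal (c * (1 / t)) * indicator {e..1} t \<partial>lborel) \<le> Gamma_integral x"
      unfolding Gamma_integral_def
    proof (intro nn_integral_mono)
      fix t :: real
      have "c * (1 / t) \<le> exp (- t) * t powr (x - 1)" if t: "e \<le> t" "t \<le> 1"
      proof (rule mult_mono)
        show "c \<le> exp (- t)" using t by (simp add: c_def)
        have "t powr (- 1) \<le> t powr (x - 1)"
          using t e assms by (intro powr_mono') auto
        then show "1 / t \<le> t powr (x - 1)"
          using t e by (simp add: powr_minus_divide)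
      qed (use t e c in auto)
      then show "ennreal (c * (1 / t)) * indicator {e..1} t
                   \<le> ennreal (exp (- t) * t powr (x - 1)) * indicator {0<..} t"
        using e by (auto simp: indicator_def intro!: ennreal_leI)
    qed
    ultimately show ?thesis
      using K by (simp add: algebra_simps)
  qed
  have "c * (ln 1 - ln (exp (- (K / c + 1)))) \<le> K"
    using divide_nonneg_pos[OF K(2) c] by (intro bound) auto
  then show False using c mult_pos_pos[OF c c] by (simp add: field_simps)
qed

end

theory Submission
  imports Defs
begin

text \<open>The distance \<open>R\<^sub>j\<close> is at most \<open>r\<close> iff the disc of radius \<open>r\<close> holds at least \<open>j\<close> points,
  so the Poisson counts say that \<open>\<Lambda>\<pi>R\<^sub>j\<^sup>2\<close> has the Erlang distribution of shape \<open>j\<close> and rate \<open>1\<close>.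
  Integrating the power \<open>-\<alpha>/2\<close> against its density gives the quotient of Gamma integrals.\<close>

section \<open>Ordering a locally finite set by distance to the origin\<close>

lemma locally_finite_cball:
  assumes "locally_finite S"
  shows "finite (S \<inter> cball c r)"
  using assms by (simp add: locally_finite_def)

text \<open>Any point \<open>c\<close> of \<open>A\<close> bounds the search: only finitely many
  points of \<open>A\<close> have norm at most \<open>norm c\<close>, and a minimum among these
  beats all the others.\<close>

lemma locally_finite_minimal_norm:
  fixes S :: "'b::real_normed_vector set"
  assumes "locally_finite S" "A \<subseteq> S" "A \<noteq> {}"
  shows "\<exists>a\<in>A. \<forall>b\<in>A. norm a \<le> norm b"
proof -
  obtain c where c: "c \<in> A" using assms by auto
  define B where "B = A \<inter> cball 0 (norm c)"
  have "finite B"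
    using assms(2) by (intro finite_subset[OF _ locally_finite_cball[OF assms(1)]]) (auto simp: B_def)
  moreover have "c \<in> B" using c by (simp add: B_def)
  ultimately obtain a where a: "a \<in> B" "\<And>b. b \<in> B \<Longrightarrow> norm a \<le> norm b"
    by (metis arg_min_if_finite(1) arg_min_least empty_iff)
  have "norm a \<le> norm b" if "b \<in> A" for b
    using a that by (cases "norm b \<le> norm c") (auto simp: B_def)
  then show ?thesis using a by (auto simp: B_def)
qed

text \<open>Greedy enumeration: remove a point of least norm again and again. Infinitude keeps the
  process running, and local finiteness ensures that every point is eventually reached.\<close>

lemma exists_distance_ordered:
  fixes S :: "'b::real_normed_vector set"
  assumes "locally_finite S" "infinite S"
  shows "\<exists>x. distance_ordered S x"
proof -
  define p where "p A = (SOME a. a \<in> A \<and> (\<forall>b\<in>A. norm a \<le> norm b))" for A :: "'b set"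
  define A where "A n = ((\<lambda>A. A - {p A}) ^^ n) S" for n
  define y where "y n = p (A n)" for n
  have A_Suc: "A (Suc n) = A n - {y n}" for n
    by (simp add: A_def y_def)
  have A_inf: "A n \<subseteq> S \<and> infinite (A n)" for n
  proof (induction n)
    case 0
    then show ?case using assms by (simp add: A_def)
  next
    case (Suc n)
    then show ?case by (auto simp: A_Suc)
  qed
  have y: "y n \<in> A n \<and> (\<forall>b\<in>A n. norm (y n) \<le> norm b)" for n
  proof -
    have "\<exists>a. a \<in> A n \<and> (\<forall>b\<in>A n. norm a \<le> norm b)"
      using locally_finite_minimal_norm[OF assms(1), of "A n"] A_inf[of n] by (metis finite.emptyI)
    then show ?thesis unfolding y_def p_def by (rule someI_ex)
  qed
  have A_eq: "A n = S - y ` {..<n}" for n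
    by (induction n) (auto simp: A_Suc lessThan_Suc, simp_all add: A_def)
  have y_in: "y n \<in> S" for n using y[of n] A_inf[of n] by auto
  have y_mono: "norm (y m) \<le> norm (y n)" if "m \<le> n" for m n
    using y[of m] y[of n] that by (auto simp: A_eq)
  have y_neq: "y m \<noteq> y n" if "m < n" for m n
    using y[of n] that by (metis A_eq DiffE imageI lessThan_iff)
  have y_inj: "inj y"
    by (rule linorder_injI) (use y_neq in auto)
  have "s \<in> range y" if s: "s \<in> S" for s
  proof (rule ccontr)
    \<comment> \<open>A point never removed stays a competitor at every stage, so each
      \<open>y n\<close> lies in the ball reaching to \<open>s\<close>; injectivity then puts
      infinitely many points of \<open>S\<close> into a bounded set.\<close>
    assume "s \<notin> range y"
    then have "norm (y n) \<le> norm s" for n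
      using y[of n] s by (auto simp: A_eq)
    then have "range y \<subseteq> S \<inter> cball 0 (norm s)"
      using y_in by auto
    then have "finite (range y)"
      using locally_finite_cball[OF assms(1)] finite_subset by blast
    then show False using y_inj by (simp add: finite_image_iff)
  qed
  then have "bij_betw y UNIV S"
    using y_in y_inj by (auto simp: bij_betw_def)
  \<comment> \<open>The enumeration \<open>y\<close> starts at 0, whereas
    \<open>distance_ordered\<close> counts from 1.\<close>
  moreover have "bij_betw (\<lambda>j. j - 1) {1::nat..} UNIV"
    by (rule bij_betw_byWitness[where f' = Suc]) auto
  ultimately have "bij_betw (y \<circ> (\<lambda>j. j - 1)) {1..} S"
    by (rule bij_betw_trans[rotated])
  then have "distance_ordered S (y \<circ> (\<lambda>j. j - 1))"
    unfolding distance_ordered_def by (auto intro!: y_mono)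
  then show ?thesis by blast
qed

text \<open>If \<open>x j\<close> lies in the ball, so do the \<open>j\<close> distinct points
  \<open>x 1\<close>, ..., \<open>x j\<close>. If it does not, monotonicity of the norms leaves room
  only for the \<open>j - 1\<close> points before it.\<close>

lemma distance_ordered_norm_le_iff:
  fixes S :: "'b::real_normed_vector set"
  assumes "locally_finite S" "distance_ordered S x" "1 \<le> j"
  shows "norm (x j) \<le> r \<longleftrightarrow> j \<le> card (S \<inter> cball 0 r)"
proof
  have bij: "bij_betw x {1..} S" and mono: "\<And>i j. 1 \<le> i \<Longrightarrow> i \<le> j \<Longrightarrow> norm (x i) \<le> norm (x j)"
    using assms(2) by (auto simp: distance_ordered_def)
  {
    assume le: "norm (x j) \<le> r"
    have "card (x ` {1..j}) \<le> card (S \<inter> cball 0 r)"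
    proof (rule card_mono[OF locally_finite_cball[OF assms(1)]])
      show "x ` {1..j} \<subseteq> S \<inter> cball 0 r"
        using le mono[of _ j] bij_betwE[OF bij] by fastforce
    qed
    moreover have "inj_on x {1..j}"
      using bij by (auto simp: bij_betw_def intro: inj_on_subset)
    ultimately show "j \<le> card (S \<inter> cball 0 r)"
      by (simp add: card_image)
  next
    assume card: "j \<le> card (S \<inter> cball 0 r)"
    show "norm (x j) \<le> r"
    proof (rule ccontr)
      assume gt: "\<not> norm (x j) \<le> r"
      have "S \<inter> cball 0 r \<subseteq> x ` {1..<j}"
      proof
        fix s assume s: "s \<in> S \<inter> cball 0 r"
        then obtain i where i: "s = x i" "1 \<le> i"
          using bij by (auto simp: bij_betw_def)
        then have "i < j" using s gt mono[of j i] assms(3) by (cases "i < j") auto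
        then show "s \<in> x ` {1..<j}" using i by auto
      qed
      then have "card (S \<inter> cball 0 r) \<le> card (x ` {1..<j})"
        by (intro card_mono) auto
      also have "\<dots> \<le> j - 1"
        using card_image_le[of "{1..<j}" x] by simp
      finally show False using card assms(3) by simp
    qed
  }
qed

text \<open>Turns events about distances into events about counts, the only quantities whose law is
  given; \<open>infinite S\<close> guarantees that the choice in \<open>nearest_point\<close> is a
  genuine ordering.\<close>

lemma nearest_dist_le_iff:
  fixes S :: "'b::real_normed_vector set"
  assumes "locally_finite S" "infinite S" "1 \<le> j"
  shows "nearest_dist S j \<le> r \<longleftrightarrow> j \<le> card (S \<inter> cball 0 r)"
proof -
  have "distance_ordered S (nearest_point S)"
    unfolding nearest_point_def using exists_distance_ordered[OF assms(1,2)] by (rule someI_ex)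
  from distance_ordered_norm_le_iff[OF assms(1) this assms(3)] show ?thesis
    by (simp add: nearest_dist_def)
qed

lemma nearest_dist_nonneg: "0 \<le> nearest_dist S j"
  by (simp add: nearest_dist_def)

section \<open>The Erlang law and the Gamma integral\<close>

lemma erlang_CDF_tendsto_1:
  "((erlang_CDF k 1) \<longlongrightarrow> 1) at_top"
proof -
  have "((\<lambda>x::real. 1 - (\<Sum>n\<le>k. (x ^ n / exp x) / fact n)) \<longlongrightarrow> 1 - (\<Sum>n\<le>k. 0 / fact n)) at_top"
    by (intro tendsto_intros tendsto_power_div_exp_0) auto
  then have "((\<lambda>x::real. 1 - (\<Sum>n\<le>k. (x ^ n / exp x) / fact n)) \<longlongrightarrow> 1) at_top"
    by simp
  then show ?thesis
    \<comment> \<open>The formula agrees with \<open>erlang_CDF\<close> only on nonnegative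
      arguments, hence the eventual congruence.\<close>
    by (rule filterlim_cong[THEN iffD1, rotated -1])
      (auto simp: erlang_CDF_def exp_minus field_simps intro!: eventually_mono[OF eventually_ge_at_top[of 0]])
qed

text \<open>The factor \<open>u powr s\<close> only shifts the exponent in the Erlang density. The
  equality is between extended values, so it includes the exponents for which the integral
  diverges.\<close>

lemma nn_integral_erlang_powr:
  "(\<integral>\<^sup>+u. ennreal (erlang_density k 1 u) * ennreal (u powr s) \<partial>lborel) =
     Gamma_integral (real (Suc k) + s) / ennreal (fact k)"
proof -
  have "ennreal (erlang_density k 1 u) * ennreal (u powr s) =
      ennreal (exp (- u) * u powr (real (Suc k) + s - 1)) * indicator {0<..} u / ennreal (fact k)" for u
  proof (cases "u > 0")
    case True
    then have "u ^ k * u powr s = u powr (real (Suc k) + s - 1)"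
      by (simp add: powr_realpow[symmetric] powr_add[symmetric])
    then have "erlang_density k 1 u * u powr s = exp (- u) * u powr (real (Suc k) + s - 1) / fact k"
      using True by (simp add: erlang_density_def mult_ac)
    then show ?thesis
      using True by (simp add: ennreal_mult[symmetric] divide_ennreal del: of_nat_Suc)
  next
    \<comment> \<open>At \<open>u = 0\<close> the density may be nonzero (for \<open>k = 0\<close>),
      but \<open>0 powr s = 0\<close> matches the open indicator \<open>{0<..}\<close>.\<close>
    case False
    then show ?thesis by (cases "u = 0") (auto simp: erlang_density_def)
  qed
  then show ?thesis
    unfolding Gamma_integral_def by (simp only:) (intro nn_integral_divide, measurable)
qed

lemma Gamma_integral_Suc: "Gamma_integral (real (Suc k)) = ennreal (fact k)"
proof -
  have "Gamma_integral (real (Suc k)) = (\<integral>\<^sup>+x. ennreal (x^k * exp (-x)) * indicator {0 ..} x \<partial>lborel)"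
    unfolding Gamma_integral_def
  proof (rule nn_integral_cong_AE)
    show "AE x in lborel. ennreal (exp (- x) * x powr (real (Suc k) - 1)) * indicator {0<..} x =
        ennreal (x^k * exp (-x)) * indicator {0 ..} x"
      \<comment> \<open>The two integrands can differ at 0, where the indicators disagree.\<close>
      using AE_lborel_singleton[of "0::real"]
      by eventually_elim (auto simp: indicator_def powr_realpow mult_ac)
  qed
  then show ?thesis by (simp only: nn_intergal_power_times_exp_Ici) simp
qed

section \<open>Counts in discs of the plane, and a measurable version of the distances\<close>

lemma measure_cball_plane:
  "0 \<le> r \<Longrightarrow> measure lborel (cball (0::real^2) r) = pi * r\<^sup>2"
  by (simp add: content_cball unit_ball_vol_2)

text \<open>Reduces infinitude to a condition on countably many disc counts, which is measurable and
  accessible to the Poisson law.\<close>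

lemma infinite_if_unbounded_count:
  assumes "\<forall>k. \<exists>n::nat. k \<le> card (S \<inter> cball 0 (real n))"
  shows "infinite S"
proof
  assume "finite S"
  then have "card (S \<inter> cball 0 (real n)) \<le> card S" for n
    by (intro card_mono) auto
  then show False
    using assms by (metis Suc_n_not_le_n order_trans)
qed

locale planar_poisson = prob_space M for M :: "'a measure" +
  fixes \<Lambda> :: real and \<Phi> :: "'a \<Rightarrow> (real^2) set"
  assumes intensity_pos: "\<Lambda> > 0"
    and poisson: "homogeneous_poisson_process M \<Lambda> \<Phi>"
begin

lemma locally_finite_points: "\<omega> \<in> space M \<Longrightarrow> locally_finite (\<Phi> \<omega>)"
  using poisson by (simp add: homogeneous_poisson_process_def)

lemma measurable_count [measurable]:
  "(\<lambda>\<omega>. card (\<Phi> \<omega> \<inter> cball 0 r)) \<in> measurable M (count_space UNIV)"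
  using poisson by (simp add: homogeneous_poisson_process_def)

text \<open>The complementary event has at most \<open>k\<close> points, and one minus the Poisson
  weights up to \<open>k\<close> is the Erlang distribution function. The index \<open>k\<close> of
  \<open>erlang_CDF\<close> stands for shape \<open>k + 1\<close>, hence
  \<open>Suc k\<close>.\<close>

lemma prob_count_ge:
  assumes "0 \<le> r"
  shows "prob {\<omega>\<in>space M. Suc k \<le> card (\<Phi> \<omega> \<inter> cball 0 r)} = erlang_CDF k 1 (\<Lambda> * pi * r\<^sup>2)"
proof -
  let ?C = "\<lambda>\<omega>. card (\<Phi> \<omega> \<inter> cball 0 r)"
  have count: "prob {\<omega>\<in>space M. ?C \<omega> = n} =
      (\<Lambda> * pi * r\<^sup>2) ^ n / fact n * exp (- (\<Lambda> * pi * r\<^sup>2))" for n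
    using poisson assms
    by (simp add: homogeneous_poisson_process_def measure_cball_plane mult.assoc)
  have "prob {\<omega>\<in>space M. ?C \<omega> \<le> k} = prob (\<Union>n\<in>{..k}. {\<omega>\<in>space M. ?C \<omega> = n})"
    by (rule arg_cong[where f = prob]) auto
  also have "\<dots> = (\<Sum>n\<le>k. prob {\<omega>\<in>space M. ?C \<omega> = n})"
    by (rule finite_measure_finite_Union) (auto simp: disjoint_family_on_def)
  finally have le: "prob {\<omega>\<in>space M. ?C \<omega> \<le> k} =
      (\<Sum>n\<le>k. (\<Lambda> * pi * r\<^sup>2) ^ n / fact n * exp (- (\<Lambda> * pi * r\<^sup>2)))"
    by (simp add: count)
  have "prob {\<omega>\<in>space M. Suc k \<le> ?C \<omega>} = prob (space M - {\<omega>\<in>space M. ?C \<omega> \<le> k})"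
    by (rule arg_cong[where f = prob]) auto
  also have "\<dots> = 1 - prob {\<omega>\<in>space M. ?C \<omega> \<le> k}"
    by (rule prob_compl) measurable
  finally show ?thesis
    using intensity_pos by (simp add: le erlang_CDF_def mult_less_0_iff power2_less_0)
qed

lemma AE_unbounded_count: "AE \<omega> in M. \<forall>k. \<exists>n::nat. k \<le> card (\<Phi> \<omega> \<inter> cball 0 (real n))"
proof (subst AE_all_countable, rule allI)
  fix k
  let ?E = "{\<omega>\<in>space M. \<exists>n::nat. k \<le> card (\<Phi> \<omega> \<inter> cball 0 (real n))}"
  \<comment> \<open>For each single radius \<open>n\<close>, the event of at least
    \<open>Suc k\<close> points in that disc is contained in \<open>?E\<close>; letting
    \<open>n\<close> grow drives its probability to 1.\<close>
  have "erlang_CDF k 1 (\<Lambda> * pi * (real n)\<^sup>2) \<le> prob ?E" for n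
    unfolding prob_count_ge[OF of_nat_0_le_iff, symmetric]
    by (rule finite_measure_mono) (auto intro: Suc_leD)
  moreover have "(\<lambda>n. erlang_CDF k 1 (\<Lambda> * pi * (real n)\<^sup>2)) \<longlonglongrightarrow> 1"
    by (rule filterlim_compose[OF erlang_CDF_tendsto_1])
      (intro filterlim_tendsto_pos_mult_at_top[OF tendsto_const] filterlim_pow_at_top
        filterlim_real_sequentially, use intensity_pos in auto)
  ultimately have "1 \<le> prob ?E"
    by (intro LIMSEQ_le_const2) auto
  then have "prob ?E = 1"
    using prob_le_1[of ?E] by linarith
  then show "AE \<omega> in M. \<exists>n::nat. k \<le> card (\<Phi> \<omega> \<inter> cball 0 (real n))"
    by (subst (asm) prob_Collect_eq_1) auto
qed

text \<open>For finite \<open>\<Phi> \<omega>\<close> the value of \<^const>\<open>nearest_dist\<close> is arbitrary and need not depend measurably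
  on \<open>\<omega>\<close>, so it is replaced by \<open>0\<close> on that null event.\<close>

definition regular_dist :: "nat \<Rightarrow> 'a \<Rightarrow> real" where
  "regular_dist j \<omega> =
     (if \<forall>k. \<exists>n::nat. k \<le> card (\<Phi> \<omega> \<inter> cball 0 (real n)) then nearest_dist (\<Phi> \<omega>) j else 0)"

lemma regular_dist_nonneg: "0 \<le> regular_dist j \<omega>"
  by (simp add: regular_dist_def nearest_dist_nonneg)

lemma AE_regular_dist: "AE \<omega> in M. regular_dist j \<omega> = nearest_dist (\<Phi> \<omega>) j"
  using AE_unbounded_count by eventually_elim (simp add: regular_dist_def)

text \<open>The right-hand side mentions only disc counts, so measurability of
  \<open>regular_dist\<close> can be read off from it.\<close>

lemma regular_dist_le_iff:
  assumes "\<omega> \<in> space M" "1 \<le> j"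
  shows "regular_dist j \<omega> \<le> r \<longleftrightarrow>
    (if \<forall>k. \<exists>n::nat. k \<le> card (\<Phi> \<omega> \<inter> cball 0 (real n))
     then j \<le> card (\<Phi> \<omega> \<inter> cball 0 r) else 0 \<le> r)"
proof (cases "\<forall>k. \<exists>n::nat. k \<le> card (\<Phi> \<omega> \<inter> cball 0 (real n))")
  case True
  then show ?thesis
    using nearest_dist_le_iff[OF locally_finite_points[OF assms(1)] infinite_if_unbounded_count[OF True] assms(2)]
    by (simp only: regular_dist_def if_True simp_thms)
next
  case False
  then show ?thesis by (simp only: regular_dist_def if_False)
qed

lemma measurable_regular_dist [measurable]:
  assumes "1 \<le> j"
  shows "regular_dist j \<in> borel_measurable M"
  unfolding borel_measurable_iff_le
proof
  fix r :: real
  have "{\<omega> \<in> space M. regular_dist j \<omega> \<le> r} = {\<omega> \<in> space M.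
    if \<forall>k. \<exists>n::nat. k \<le> card (\<Phi> \<omega> \<inter> cball 0 (real n))
     then j \<le> card (\<Phi> \<omega> \<inter> cball 0 r) else 0 \<le> r}"
    using regular_dist_le_iff[OF _ assms] by blast
  also have "\<dots> \<in> sets M" by measurable
  finally show "{\<omega> \<in> space M. regular_dist j \<omega> \<le> r} \<in> sets M" .
qed

section \<open>The law of the j-th distance and its moment of order -\<alpha>\<close>

lemma prob_regular_dist_le:
  assumes "0 \<le> r"
  shows "prob {\<omega>\<in>space M. regular_dist (Suc k) \<omega> \<le> r} = erlang_CDF k 1 (\<Lambda> * pi * r\<^sup>2)"
proof -
  have "prob {\<omega>\<in>space M. regular_dist (Suc k) \<omega> \<le> r} =
      prob {\<omega>\<in>space M. Suc k \<le> card (\<Phi> \<omega> \<inter> cball 0 r)}"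
  proof (rule finite_measure_eq_AE)
    show "AE \<omega> in M. (\<omega> \<in> {\<omega>\<in>space M. regular_dist (Suc k) \<omega> \<le> r}) =
        (\<omega> \<in> {\<omega>\<in>space M. Suc k \<le> card (\<Phi> \<omega> \<inter> cball 0 r)})"
      using AE_unbounded_count AE_space
      by eventually_elim (use regular_dist_le_iff[of _ "Suc k"] in simp)
  qed (use measurable_regular_dist[of "Suc k"] in measurable)
  then show ?thesis using prob_count_ge[OF assms] by simp
qed

text \<open>The mean number of points in the disc of radius R_j is Erlang distributed, because
  squaring is increasing on nonnegative radii and so carries the distribution function over.\<close>

lemma erlang_distributed_regular_dist:
  "distributed M lborel (\<lambda>\<omega>. \<Lambda> * pi * (regular_dist (Suc k) \<omega>)\<^sup>2) (erlang_density k 1)"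
proof (subst erlang_distributed_iff, simp, intro conjI allI impI)
  have [measurable]: "regular_dist (Suc k) \<in> borel_measurable M" by simp
  show "random_variable borel (\<lambda>\<omega>. \<Lambda> * pi * (regular_dist (Suc k) \<omega>)\<^sup>2)" by measurable
  fix a :: real assume a: "0 \<le> a"
  have c: "0 < \<Lambda> * pi" using intensity_pos by simp
  \<comment> \<open>The radius of the disc whose mean number of points is \<open>a\<close>.\<close>
  define r where "r = sqrt (a / (\<Lambda> * pi))"
  have r: "0 \<le> r" "\<Lambda> * pi * r\<^sup>2 = a"
    using a c intensity_pos by (auto simp: r_def)
  have "\<Lambda> * pi * x\<^sup>2 \<le> a \<longleftrightarrow> x \<le> r" if "0 \<le> x" for x
    using r c that by (metis mult_le_cancel_left_pos power_mono_iff zero_less_numeral)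
  then have "\<Lambda> * pi * (regular_dist (Suc k) \<omega>)\<^sup>2 \<le> a \<longleftrightarrow> regular_dist (Suc k) \<omega> \<le> r" for \<omega>
    using regular_dist_nonneg by blast
  then show "prob {\<omega> \<in> space M. \<Lambda> * pi * (regular_dist (Suc k) \<omega>)\<^sup>2 \<le> a} = erlang_CDF k 1 a"
    using prob_regular_dist_le[OF r(1)] r(2) by simp
qed simp

text \<open>Up to the constant \<open>(\<Lambda> * pi) powr (\<alpha> / 2)\<close>, the integrand is
  the power \<open>- (\<alpha> / 2)\<close> of the Erlang variable, so its mean is an integral
  against the Erlang density.\<close>

lemma nn_integral_regular_dist_powr:
  assumes "1 \<le> j"
  shows "(\<integral>\<^sup>+\<omega>. ennreal (regular_dist j \<omega> powr (- \<alpha>)) \<partial>M) =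
    ennreal ((\<Lambda> * pi) powr (\<alpha> / 2)) * Gamma_integral (real j - \<alpha> / 2) / Gamma_integral (real j)"
proof -
  obtain k where k: "j = Suc k" using assms by (cases j) auto
  have [measurable]: "regular_dist j \<in> borel_measurable M" using assms by simp
  have c: "0 < \<Lambda> * pi" using intensity_pos by simp
  \<comment> \<open>At \<open>x = 0\<close> both sides are 0 by the convention
    \<open>0 powr y = 0\<close>.\<close>
  have powr: "x powr (- \<alpha>) = (\<Lambda> * pi) powr (\<alpha> / 2) * (\<Lambda> * pi * x\<^sup>2) powr (- (\<alpha> / 2))" if "0 \<le> x" for x
  proof (cases "x = 0")
    case False
    have "(\<Lambda> * pi * x\<^sup>2) powr (- (\<alpha> / 2)) = (\<Lambda> * pi) powr (- (\<alpha> / 2)) * (x powr 2) powr (- (\<alpha> / 2))"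
      using c that by (subst powr_mult[symmetric]) auto
    moreover have "(x powr 2) powr (- (\<alpha> / 2)) = x powr (- \<alpha>)"
      by (simp add: powr_powr)
    moreover have "(\<Lambda> * pi) powr (\<alpha> / 2) * (\<Lambda> * pi) powr (- (\<alpha> / 2)) = 1"
      using intensity_pos by (simp add: powr_add[symmetric])
    ultimately show ?thesis by (metis mult.assoc mult_1)
  qed simp
  have "(\<integral>\<^sup>+\<omega>. ennreal (regular_dist j \<omega> powr (- \<alpha>)) \<partial>M) =
      (\<integral>\<^sup>+\<omega>. ennreal ((\<Lambda> * pi) powr (\<alpha> / 2)) *
         ennreal ((\<Lambda> * pi * (regular_dist j \<omega>)\<^sup>2) powr (- (\<alpha> / 2))) \<partial>M)"
    by (simp add: powr[OF regular_dist_nonneg] ennreal_mult[symmetric])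
  also have "\<dots> = ennreal ((\<Lambda> * pi) powr (\<alpha> / 2)) *
      (\<integral>\<^sup>+\<omega>. ennreal ((\<Lambda> * pi * (regular_dist j \<omega>)\<^sup>2) powr (- (\<alpha> / 2))) \<partial>M)"
    by (rule nn_integral_cmult) measurable
  also have "(\<integral>\<^sup>+\<omega>. ennreal ((\<Lambda> * pi * (regular_dist j \<omega>)\<^sup>2) powr (- (\<alpha> / 2))) \<partial>M) =
      (\<integral>\<^sup>+u. ennreal (erlang_density k 1 u) * ennreal (u powr (- (\<alpha> / 2))) \<partial>lborel)"
    unfolding k
    by (rule distributed_nn_integral[OF erlang_distributed_regular_dist, symmetric]) measurable
  also have "\<dots> = Gamma_integral (real j - \<alpha> / 2) / Gamma_integral (real j)"
    unfolding k Gamma_integral_Suc using nn_integral_erlang_powr[of k "- (\<alpha> / 2)"] by simp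
  finally show ?thesis by (simp add: ennreal_times_divide)
qed

end

section \<open>Summing the moments over the interferers\<close>

theorem mainTheorem3:
  fixes M :: "'a measure" and \<Phi> :: "'a \<Rightarrow> (real^2) set"
    and \<Lambda> \<alpha> :: real and N :: nat and P :: "nat \<Rightarrow> real"
  assumes "prob_space M"
    and "\<Lambda> > 0"
    and "homogeneous_poisson_process M \<Lambda> \<Phi>"
    and "\<alpha> > 0"
    and "N \<ge> 1"
    and "\<And>j. j \<in> {2..N+1} \<Longrightarrow> P j > 0"
  shows "(\<integral>\<^sup>+\<omega>. ennreal (\<Sum>j=2..N+1. P j * nearest_dist (\<Phi> \<omega>) j powr (- \<alpha>)) \<partial>M) =
    (\<Sum>j=2..N+1. ennreal (P j) *
       (ennreal ((\<Lambda> * pi) powr (\<alpha> / 2)) * Gamma_integral (real j - \<alpha> / 2) / Gamma_integral (real j)))"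
proof -
  interpret planar_poisson M \<Lambda> \<Phi>
    using assms by (simp add: planar_poisson_def planar_poisson_axioms_def)
  have meas: "(\<lambda>\<omega>. ennreal (regular_dist j \<omega> powr (- \<alpha>))) \<in> borel_measurable M"
    if "j \<in> {2..N+1}" for j
  proof -
    have [measurable]: "regular_dist j \<in> borel_measurable M" using that by simp
    show ?thesis by measurable
  qed
  \<comment> \<open>The exceptional null sets of countably many j are merged, so all distances are
    replaced by their measurable versions at once.\<close>
  have "AE \<omega> in M. \<forall>j. regular_dist j \<omega> = nearest_dist (\<Phi> \<omega>) j"
    using AE_regular_dist by (simp add: AE_all_countable)
  then have "(\<integral>\<^sup>+\<omega>. ennreal (\<Sum>j=2..N+1. P j * nearest_dist (\<Phi> \<omega>) j powr (- \<alpha>)) \<partial>M) =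
      (\<integral>\<^sup>+\<omega>. (\<Sum>j=2..N+1. ennreal (P j) * ennreal (regular_dist j \<omega> powr (- \<alpha>))) \<partial>M)"
  proof (intro nn_integral_cong_AE, eventually_elim)
    case (elim \<omega>)
    \<comment> \<open>\<open>ennreal\<close> truncates negative reals to 0; it commutes with the sum
      because positive powers \<open>P j\<close> make every term nonnegative.\<close>
    have "ennreal (\<Sum>j=2..N+1. P j * nearest_dist (\<Phi> \<omega>) j powr (- \<alpha>)) =
        (\<Sum>j=2..N+1. ennreal (P j * nearest_dist (\<Phi> \<omega>) j powr (- \<alpha>)))"
      using assms(6) by (intro sum_ennreal[symmetric] mult_nonneg_nonneg powr_ge_zero) (auto intro: less_imp_le)
    also have "\<dots> = (\<Sum>j=2..N+1. ennreal (P j) * ennreal (regular_dist j \<omega> powr (- \<alpha>)))"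
      using assms(6) elim by (intro sum.cong refl) (auto simp: ennreal_mult less_imp_le)
    finally show ?case .
  qed
  also have "\<dots> = (\<Sum>j=2..N+1. \<integral>\<^sup>+\<omega>. ennreal (P j) * ennreal (regular_dist j \<omega> powr (- \<alpha>)) \<partial>M)"
    using meas by (intro nn_integral_sum borel_measurable_times_ennreal) auto
  also have "\<dots> = (\<Sum>j=2..N+1. ennreal (P j) *
       (ennreal ((\<Lambda> * pi) powr (\<alpha> / 2)) * Gamma_integral (real j - \<alpha> / 2) / Gamma_integral (real j)))"
    using meas by (intro sum.cong refl) (simp add: nn_integral_cmult nn_integral_regular_dist_powr)
  finally show ?thesis .
qed

end
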